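(* Let $r\ge1$, let $p_1,\dots,p_r\ge5$ be distinct primes and $P=p_1\cdots p_r$. With the notation of the context, for every positive integer $n$, $$g_P(2n)=0\quad\Longleftrightarrow\quad\mathcal C_P(n)=0\quad\Longleftrightarrow\quad\mathcal Z(n)\subseteq\bigcup_{i=1}^r\bigl(X_i(n)\cup Y_i(n)\bigr).$$
   Context: $M=6P$. For $q\in\mathbb Z_{>0}$ and $x\in\mathbb Z$, $\delta_q(x)=x-q\lfloor x/q\rfloor\in\{0,\dots,q-1\}$. $g_P(2n)$ is the number of pairs $(h,k)\in\mathbb Z_{>0}^2$ with $h+k=2n$, $h\le k$, $\gcd(h,M)=\gcd(k,M)=1$. For a prime $p\ge5$: $a(p)=\frac{p\,\delta_6(p)-1}{6}$ and $b(p)=p-1-a(p)$ (both integers in $\{0,\dots,p-1\}$). Write $a_i=a(p_i)$, $b_i=b(p_i)$. $m(n)=\frac n3-1$ if $\delta_3(n)=0$; $m(n)=\frac{n-1}{3}$ if $\delta_3(n)=1$; $m(n)=\frac{n-5}{3}$ if $\delta_3(n)=2$. $\mathcal Z(n)=\{z\in\mathbb Z:0\le z\le m(n)\}$ (empty for $n=2$, where $m(2)=-1$). For $z\in\mathcal Z(n)$: if $\delta_3(n)=0$, $H_z(n)=6z+1$, $K_z(n)=6(m(n)-z)+5$; if $\delta_3(n)=1$, $H_z(n)=6z+1$, $K_z(n)=6(m(n)-z)+1$; if $\delta_3(n)=2$, $H_z(n)=6z+5$, $K_z(n)=6(m(n)-z)+5$. $\mathcal C_P(n)=\#\{z\in\mathcal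 Z(n):\gcd(H_z(n)K_z(n),P)=1\}$. For $1\le i\le r$: if $\delta_3(n)=0$, $x_i(n)=a_i$, $y_i(n)=\delta_{p_i}(m(n)-b_i)$; if $\delta_3(n)=1$, $x_i(n)=a_i$, $y_i(n)=\delta_{p_i}(m(n)-a_i)$; if $\delta_3(n)=2$, $x_i(n)=b_i$, $y_i(n)=\delta_{p_i}(m(n)-b_i)$. Finally $X_i(n)=\{z\in\mathcal Z(n):\delta_{p_i}(z)=x_i(n)\}$ and $Y_i(n)=\{z\in\mathcal Z(n):\delta_{p_i}(z)=y_i(n)\}$. *)

theory Defs
  imports Complex_Main "HOL-Computational_Algebra.Primes"
begin

definition delta :: "int \<Rightarrow> int \<Rightarrow> int" where
  "delta q x = x - q * \<lfloor>real_of_int x / real_of_int q\<rfloor>"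

lemma delta_eq_mod: "delta q x = x mod q"
  by (simp add: delta_def floor_divide_of_int_eq minus_mult_div_eq_mod)

definition admissible_pairs :: "int \<Rightarrow> int \<Rightarrow> (int \<times> int) set" where
  "admissible_pairs P N =
     {(h, k). h > 0 \<and> k > 0 \<and> h + k = N \<and> h \<le> k \<and> gcd h (6 * P) = 1 \<and> gcd k (6 * P) = 1}"

lemma finite_admissible_pairs: "finite (admissible_pairs P N)"
  by (rule finite_subset[of _ "{0..N} \<times> {0..N}"]) (auto simp: admissible_pairs_def)

definition g_count :: "int \<Rightarrow> int \<Rightarrow> nat" where
  "g_count P N = card (admissible_pairs P N)"

text \<open>
  The divisions in \<open>a_res\<close> and \<open>m_par\<close> are exact where they are used; see the
  lemmas \<open>a_res_exact\<close>, \<open>a_res_range\<close>, \<open>b_res_range\<close> and \<open>m_par_exact\<close>.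
\<close>

definition a_res :: "int \<Rightarrow> int" where
  "a_res p = (p * delta 6 p - 1) div 6"

definition b_res :: "int \<Rightarrow> int" where
  "b_res p = p - 1 - a_res p"

definition m_par :: "int \<Rightarrow> int" where
  "m_par n = (if delta 3 n = 0 then n div 3 - 1
              else if delta 3 n = 1 then (n - 1) div 3
              else (n - 5) div 3)"

definition Z_set :: "int \<Rightarrow> int set" where
  "Z_set n = {z. 0 \<le> z \<and> z \<le> m_par n}"

definition H_val :: "int \<Rightarrow> int \<Rightarrow> int" where
  "H_val n z = (if delta 3 n = 0 then 6 * z + 1
                else if delta 3 n = 1 then 6 * z + 1
                else 6 * z + 5)"

definition K_val :: "int \<Rightarrow> int \<Rightarrow> int" where
  "K_val n z = (if delta 3 n = 0 then 6 * (m_par n - z) + 5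
                else if delta 3 n = 1 then 6 * (m_par n - z) + 1
                else 6 * (m_par n - z) + 5)"

definition C_count :: "int \<Rightarrow> int \<Rightarrow> nat" where
  "C_count P n = card {z \<in> Z_set n. gcd (H_val n z * K_val n z) P = 1}"

text \<open>
  The index \<open>i\<close> enters the residues and residue classes below only through the prime
  \<open>p\<^sub>i\<close>, which is therefore the first argument.
\<close>

definition x_res :: "int \<Rightarrow> int \<Rightarrow> int" where
  "x_res p n = (if delta 3 n = 0 then a_res p
                else if delta 3 n = 1 then a_res p
                else b_res p)"

definition y_res :: "int \<Rightarrow> int \<Rightarrow> int" where
  "y_res p n = (if delta 3 n = 0 then delta p (m_par n - b_res p)
                else if delta 3 n = 1 then delta p (m_par n - a_res p)
                else delta p (m_par n - b_res p))"

definition X_set :: "int \<Rightarrow> int \<Rightarrow> int set" where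
  "X_set p n = {z \<in> Z_set n. delta p z = x_res p n}"

definition Y_set :: "int \<Rightarrow> int \<Rightarrow> int set" where
  "Y_set p n = {z \<in> Z_set n. delta p z = y_res p n}"

lemma finite_Z_set: "finite (Z_set n)"
  by (rule finite_subset[of _ "{0..m_par n}"]) (auto simp: Z_set_def)

lemma m_par_exact:
  "delta 3 n = 0 \<Longrightarrow> 3 * (m_par n + 1) = n"
  "delta 3 n = 1 \<Longrightarrow> 3 * m_par n = n - 1"
  "delta 3 n = 2 \<Longrightarrow> 3 * m_par n = n - 5"
  unfolding m_par_def delta_eq_mod by presburger+

lemma prime_ge_5_mod_6:
  fixes p :: int
  assumes "prime p" "p \<ge> 5"
  shows "p mod 6 = 1 \<or> p mod 6 = 5"
proof -
  have "\<not> 2 dvd p" "\<not> 3 dvd p"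
    using assms primes_dvd_imp_eq[of 2 p] primes_dvd_imp_eq[of 3 p] by auto
  then show ?thesis by presburger
qed

lemma a_res_exact:
  assumes "prime p" "p \<ge> 5"
  shows "6 * a_res p = p * delta 6 p - 1"
  using prime_ge_5_mod_6[OF assms]
proof
  assume *: "p mod 6 = 1"
  then have "6 * ((p - 1) div 6) = p - 1" by presburger
  with * show ?thesis by (simp add: a_res_def delta_eq_mod)
next
  assume *: "p mod 6 = 5"
  then have "6 * ((p * 5 - 1) div 6) = p * 5 - 1" by presburger
  with * show ?thesis by (simp add: a_res_def delta_eq_mod)
qed

lemma a_res_range:
  assumes "prime p" "p \<ge> 5"
  shows "a_res p \<in> {0..p - 1}"
  using prime_ge_5_mod_6[OF assms] a_res_exact[OF assms] assms(2)
  by (auto simp: delta_eq_mod)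

lemma b_res_range:
  assumes "prime p" "p \<ge> 5"
  shows "b_res p \<in> {0..p - 1}"
  using a_res_range[OF assms] by (auto simp: b_res_def)

end

theory Submission
  imports Defs
begin

text \<open>
  Modulo 6, two integers coprime to 6 with sum \<open>2n\<close> lie in the classes \<open>{1, 5}\<close>, \<open>{1, 1}\<close> or
  \<open>{5, 5}\<close> according to \<open>n mod 3\<close>, so up to order they are \<open>H\<^sub>z(n)\<close> and \<open>K\<^sub>z(n)\<close> for some \<open>z\<close>.
  For a prime \<open>p \<ge> 5\<close>, the residues \<open>a(p)\<close> and \<open>b(p)\<close> are the roots of \<open>6z + 1\<close> and \<open>6z + 5\<close>
  modulo \<open>p\<close>; hence \<open>X\<^sub>i(n)\<close> and \<open>Y\<^sub>i(n)\<close> consist of the \<open>z\<close> for which \<open>p\<^sub>i\<close> divides \<open>H\<^sub>z(n)\<close>,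
  respectively \<open>K\<^sub>z(n)\<close>.
\<close>

lemma coprime_prime_right_iff: "prime p \<Longrightarrow> coprime x p \<longleftrightarrow> \<not> p dvd x" for p x :: int
  by (metis coprime_absorb_left coprime_commute not_prime_unit prime_imp_coprime)

lemma coprime_prod_right_iff:
  fixes x :: int
  assumes "finite A"
  shows "coprime x (\<Prod>i\<in>A. f i) \<longleftrightarrow> (\<forall>i\<in>A. coprime x (f i))"
  using assms by induction auto

lemma coprime_6_iff_mod: "coprime x (6 :: int) \<longleftrightarrow> x mod 6 = 1 \<or> x mod 6 = 5"
proof -
  have "coprime x 6 \<longleftrightarrow> coprime x 2 \<and> coprime x 3"
    using coprime_mult_right_iff[of x 2 3] by simp
  also have "\<dots> \<longleftrightarrow> \<not> 2 dvd x \<and> \<not> 3 dvd x"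
    using coprime_prime_right_iff[of 2 x] coprime_prime_right_iff[of 3 x] by simp
  also have "\<dots> \<longleftrightarrow> x mod 6 = 1 \<or> x mod 6 = 5"
    by presburger
  finally show ?thesis .
qed

lemma delta_3_cases:
  obtains "delta 3 n = 0" | "delta 3 n = 1" | "delta 3 n = 2"
  unfolding delta_eq_mod by linarith

lemma H_K_val_properties:
  assumes "z \<in> Z_set n"
  shows "H_val n z > 0" "K_val n z > 0" "H_val n z + K_val n z = 2 * n"
    "coprime (H_val n z) 6" "coprime (K_val n z) 6"
proof -
  have "H_val n z mod 6 = 1 \<or> H_val n z mod 6 = 5" "K_val n z mod 6 = 1 \<or> K_val n z mod 6 = 5"
    unfolding H_val_def K_val_def by presburger+
  then show "coprime (H_val n z) 6" "coprime (K_val n z) 6"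
    by (auto simp: coprime_6_iff_mod)
  show "H_val n z > 0" "K_val n z > 0"
    using assms by (auto simp: Z_set_def H_val_def K_val_def)
  show "H_val n z + K_val n z = 2 * n"
    by (cases n rule: delta_3_cases) (use m_par_exact[of n] in \<open>auto simp: H_val_def K_val_def\<close>)
qed

text \<open>The residue of \<open>2 * n\<close> modulo 6 fixes the classes of \<open>h\<close> and
  \<open>k\<close> up to order. Only the mixed classes 1 and 5 may require a swap, and then
  \<open>z\<close> is the quotient by 6 of the summand in class 1.\<close>

lemma coprime_6_pair_eq_H_K_val:
  assumes "h > 0" "k > 0" "h + k = 2 * n" "coprime h 6" "coprime k 6"
  obtains z where "z \<in> Z_set n"
    "h = H_val n z \<and> k = K_val n z \<or> h = K_val n z \<and> k = H_val n z"
proof -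
  have h: "h mod 6 = 1 \<or> h mod 6 = 5" and k: "k mod 6 = 1 \<or> k mod 6 = 5"
    using assms by (auto simp: coprime_6_iff_mod)
  have h6: "h = 6 * (h div 6) + h mod 6" and k6: "k = 6 * (k div 6) + k mod 6"
    by simp_all
  \<comment> \<open>In every case the two quotients add up to \<open>m_par n\<close>, so their
    nonnegativity is the condition that either of them lies in \<open>Z_set n\<close>.\<close>
  have nonneg: "h div 6 \<ge> 0" "k div 6 \<ge> 0"
    using assms by (simp_all add: pos_imp_zdiv_nonneg_iff)
  show thesis
  proof (cases n rule: delta_3_cases)
    case 1
    then have m: "3 * (m_par n + 1) = n" by (rule m_par_exact)
    with assms(3) h k have "h mod 6 = 1 \<and> k mod 6 = 5 \<or> h mod 6 = 5 \<and> k mod 6 = 1"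
      by presburger
    then show thesis
    proof
      assume *: "h mod 6 = 1 \<and> k mod 6 = 5"
      with h6 k6 m assms(3) nonneg 1 show thesis
        by (intro that[of "h div 6"]) (auto simp: Z_set_def H_val_def K_val_def)
    next
      assume *: "h mod 6 = 5 \<and> k mod 6 = 1"
      with h6 k6 m assms(3) nonneg 1 show thesis
        by (intro that[of "k div 6"]) (auto simp: Z_set_def H_val_def K_val_def)
    qed
  next
    case 2
    then have m: "3 * m_par n = n - 1" by (rule m_par_exact)
    with assms(3) h k have "h mod 6 = 1 \<and> k mod 6 = 1" by presburger
    with h6 k6 m assms(3) nonneg 2 show thesis
      by (intro that[of "h div 6"]) (auto simp: Z_set_def H_val_def K_val_def)
  next
    case 3
    then have m: "3 * m_par n = n - 5" by (rule m_par_exact)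
    with assms(3) h k have "h mod 6 = 5 \<and> k mod 6 = 5" by presburger
    with h6 k6 m assms(3) nonneg 3 show thesis
      by (intro that[of "h div 6"]) (auto simp: Z_set_def H_val_def K_val_def)
  qed
qed

text \<open>Only the existence of a pair matters. The parameters \<open>z\<close> and
  \<open>m_par n - z\<close> may yield the same unordered pair, so \<open>g_count\<close> and
  \<open>C_count\<close> can differ, but they vanish together.\<close>

lemma g_count_eq_0_iff:
  "g_count P (2 * n) = 0 \<longleftrightarrow> (\<forall>z\<in>Z_set n. \<not> coprime (H_val n z * K_val n z) P)"
proof -
  have "admissible_pairs P (2 * n) \<noteq> {} \<longleftrightarrow> (\<exists>z\<in>Z_set n. coprime (H_val n z * K_val n z) P)"
  proof
    assume "admissible_pairs P (2 * n) \<noteq> {}"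
    then obtain h k where "h > 0" "k > 0" "h + k = 2 * n" "coprime h (6 * P)" "coprime k (6 * P)"
      by (auto simp: admissible_pairs_def simp flip: coprime_iff_gcd_eq_1)
    then show "\<exists>z\<in>Z_set n. coprime (H_val n z * K_val n z) P"
      by (elim coprime_6_pair_eq_H_K_val[of h k n]) auto
  next
    assume "\<exists>z\<in>Z_set n. coprime (H_val n z * K_val n z) P"
    then obtain z where z: "z \<in> Z_set n" "coprime (H_val n z * K_val n z) P" by blast
    \<comment> \<open>Sorting meets the condition \<open>h \<le> k\<close>; all other conditions are
      symmetric.\<close>
    define h k where "h = min (H_val n z) (K_val n z)" and "k = max (H_val n z) (K_val n z)"
    have "(h, k) \<in> admissible_pairs P (2 * n)"
      using H_K_val_properties[OF z(1)] z(2)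
      by (auto simp: admissible_pairs_def h_def k_def min_def max_def
          simp flip: coprime_iff_gcd_eq_1)
    then show "admissible_pairs P (2 * n) \<noteq> {}" by blast
  qed
  then show ?thesis
    using finite_admissible_pairs[of P "2 * n"] by (auto simp: g_count_def)
qed

lemma C_count_eq_0_iff:
  "C_count P n = 0 \<longleftrightarrow> (\<forall>z\<in>Z_set n. \<not> coprime (H_val n z * K_val n z) P)"
  using finite_Z_set[of n] by (auto simp: C_count_def simp flip: coprime_iff_gcd_eq_1)

context
  fixes p :: int
  assumes p: "prime p" "p \<ge> 5"
begin

lemma dvd_6_mult_iff: "p dvd 6 * x \<longleftrightarrow> p dvd x"
proof -
  have "coprime p 6"
    using prime_ge_5_mod_6[OF p] by (simp add: coprime_6_iff_mod)
  then show ?thesis by (rule coprime_dvd_mult_right_iff)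
qed

text \<open>By \<open>a_res_exact\<close>, \<open>a_res p\<close> is a root of
  \<open>6 * z + 1\<close> modulo \<open>p\<close>, and 6 is invertible there.\<close>

lemma dvd_6_mult_plus_1_iff: "p dvd 6 * z + 1 \<longleftrightarrow> p dvd z - a_res p"
proof -
  have "6 * z + 1 = 6 * (z - a_res p) + p * delta 6 p"
    using a_res_exact[OF p] by (simp add: algebra_simps)
  then have "p dvd 6 * z + 1 \<longleftrightarrow> p dvd 6 * (z - a_res p)"
    by (simp only: dvd_add_left_iff[OF dvd_triv_left])
  then show ?thesis by (simp only: dvd_6_mult_iff)
qed

lemma dvd_6_mult_plus_5_iff: "p dvd 6 * z + 5 \<longleftrightarrow> p dvd z - b_res p"
proof -
  \<comment> \<open>The substitution of \<open>-1 - z\<close> for \<open>z\<close> turns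
    \<open>6 * z + 1\<close> into \<open>-(6 * z + 5)\<close>, and \<open>b_res p\<close> is
    congruent to \<open>-1 - a_res p\<close>.\<close>
  have "6 * z + 5 = 6 * (z - b_res p) + p * (6 - delta 6 p)"
    using a_res_exact[OF p] by (simp add: b_res_def algebra_simps)
  then have "p dvd 6 * z + 5 \<longleftrightarrow> p dvd 6 * (z - b_res p)"
    by (simp only: dvd_add_left_iff[OF dvd_triv_left])
  then show ?thesis by (simp only: dvd_6_mult_iff)
qed

text \<open>The range makes \<open>a\<close> its own remainder modulo \<open>p\<close>.\<close>

lemma delta_eq_residue_iff:
  assumes "a \<in> {0..p - 1}"
  shows "delta p z = a \<longleftrightarrow> p dvd z - a"
  using assms by (simp add: delta_eq_mod flip: mod_eq_dvd_iff)

lemma delta_eq_reflected_iff: "delta p z = delta p (m - a) \<longleftrightarrow> p dvd (m - z) - a"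
proof -
  have "delta p z = delta p (m - a) \<longleftrightarrow> p dvd z - (m - a)"
    by (simp add: delta_eq_mod mod_eq_dvd_iff)
  also have "\<dots> \<longleftrightarrow> p dvd (m - z) - a"
    by (subst dvd_minus_iff[symmetric]) (simp add: algebra_simps)
  finally show ?thesis .
qed

lemma mem_X_set_iff: "z \<in> X_set p n \<longleftrightarrow> z \<in> Z_set n \<and> p dvd H_val n z"
  using a_res_range[OF p] b_res_range[OF p]
  by (simp add: X_set_def x_res_def H_val_def delta_eq_residue_iff
      dvd_6_mult_plus_1_iff dvd_6_mult_plus_5_iff del: atLeastAtMost_iff)

lemma mem_Y_set_iff: "z \<in> Y_set p n \<longleftrightarrow> z \<in> Z_set n \<and> p dvd K_val n z"
  \<comment> \<open>The factor \<open>6 * (m_par n - z)\<close> must stay unexpanded, so that the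
    root criteria apply with \<open>m_par n - z\<close> in place of \<open>z\<close>.\<close>
  by (simp add: Y_set_def y_res_def K_val_def delta_eq_reflected_iff
      dvd_6_mult_plus_1_iff dvd_6_mult_plus_5_iff del: right_diff_distrib_numeral)

end

theorem proposition5p5:
  fixes r :: nat and p :: "nat \<Rightarrow> int" and P n :: int
  assumes "r \<ge> 1"
    and "\<And>i. i \<in> {1..r} \<Longrightarrow> prime (p i) \<and> p i \<ge> 5"
    and "inj_on p {1..r}"
    and "P = (\<Prod>i=1..r. p i)"
    and "n > 0"
  shows "(g_count P (2 * n) = 0 \<longleftrightarrow> C_count P n = 0) \<and>
         (C_count P n = 0 \<longleftrightarrow> Z_set n \<subseteq> (\<Union>i\<in>{1..r}. X_set (p i) n \<union> Y_set (p i) n))"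
proof
  show "g_count P (2 * n) = 0 \<longleftrightarrow> C_count P n = 0"
    by (simp add: g_count_eq_0_iff C_count_eq_0_iff)
  have "\<not> coprime (H_val n z * K_val n z) P \<longleftrightarrow> z \<in> (\<Union>i\<in>{1..r}. X_set (p i) n \<union> Y_set (p i) n)"
    if z: "z \<in> Z_set n" for z
  proof -
    \<comment> \<open>The product of \<open>H_val\<close> and \<open>K_val\<close> is kept whole
      until a single prime is reached, where primality splits the divisibility.\<close>
    have "\<not> coprime (H_val n z * K_val n z) P \<longleftrightarrow>
        (\<exists>i\<in>{1..r}. \<not> coprime (H_val n z * K_val n z) (p i))"
      unfolding assms(4) by (simp add: coprime_prod_right_iff del: coprime_mult_left_iff)
    also have "\<dots> \<longleftrightarrow> (\<exists>i\<in>{1..r}. p i dvd H_val n z \<or> p i dvd K_val n z)"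
      using assms(2) by (intro bex_cong refl)
        (simp add: coprime_prime_right_iff prime_dvd_mult_iff del: coprime_mult_left_iff)
    also have "\<dots> \<longleftrightarrow> z \<in> (\<Union>i\<in>{1..r}. X_set (p i) n \<union> Y_set (p i) n)"
      using z assms(2) by (simp add: mem_X_set_iff mem_Y_set_iff)
    finally show ?thesis .
  qed
  then show "C_count P n = 0 \<longleftrightarrow> Z_set n \<subseteq> (\<Union>i\<in>{1..r}. X_set (p i) n \<union> Y_set (p i) n)"
    unfolding C_count_eq_0_iff by blast
qed

end
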